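(* Let $\{\mathsf{P}_\theta : \theta \in \mathbb{T}\}$ be a statistical model on $\mathbb{X}$ with relative likelihood $\eta(x,\theta)$, possibility contour $\pi_x(\theta) = \mathsf{P}_\theta\{\eta(X,\theta) \le \eta(x,\theta)\}$, and possibility measure $\overline{\Pi}_x(A) = \sup_{\theta \in A} \pi_x(\theta)$, $A \subseteq \mathbb{T}$. Hypothesis testing and confidence set procedures derived from the corresponding inferential model control frequentist error rates at the nominal levels. That is, for every $\alpha \in [0,1]$: 1. For a hypothesis $H: \Theta \in A$, with $A \subseteq \mathbb{T}$, the test that rejects $H$ if and only if $\overline{\Pi}_X(A) \leq \alpha$ has Type I error probability bounded above by $\alpha$, i.e., $\mathsf{P}_\Theta\{\overline{\Pi}_X(A) \le \alpha\} \le \alpha$ for all $\Theta \in A$. 2. The set $C_\alpha(X) = \{\theta \in \mathbb{T} : \pi_X(\theta) > \alpha\}$ has coverage probability bounded below by $1-\alpha$, i.e., $\mathsf{P}_\Theta\{C_\alpha(X) \ni \Theta\} \ge 1-\alpha$ for all $\Theta \in \mathbb{T}$.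
   Context: $X$ denotes observable data taking values in a sample space $\mathbb{X}$. The model is a family $\{\mathsf{P}_\theta : \theta \in \mathbb{T}\}$ of probability distributions on $\mathbb{X}$, indexed by a parameter space $\mathbb{T}$; $\mathsf{P}_\theta\{\cdots\}$ is probability computed with $X \sim \mathsf{P}_\theta$, and $\Theta$ denotes the true parameter value. Each $\mathsf{P}_\theta$ has a probability mass or density function $p_\theta$ on $\mathbb{X}$ (with respect to a common dominating measure). The likelihood at $x \in \mathbb{X}$ is $L_x(\theta) = p_\theta(x)$, and the relative likelihood is $$\eta(x,\theta) = \frac{L_x(\theta)}{\sup_{\vartheta \in \mathbb{T}} L_x(\vartheta)}, \quad x \in \mathbb{X},\ \theta \in \mathbb{T}.$$ It is assumed that $0 < \sup_{\vartheta} L_x(\vartheta) < \infty$ so that $\eta$ is well defined with values in $[0,1]$, and that $x \mapsto \eta(x,\theta)$ is measurable for each $\theta$; the event $\{\overline{\Pi}_X(A) \le \alpha\}$ is assumed measurable (or its probability is read as outer probability). The possibility contour is, for fixed $x \in \mathbb{X}$, $$\pi_x(\theta) = \mathsf{P}_\theta\{ \eta(X,\theta) \leq \eta(x,\theta)\}, \quad \theta \in \mathbb{T},$$ where the probability is over $X \sim \mathsf{P}_\theta$ with $x$ held fixed. The associated possibility measure is $\overline{\Pi}_x(A) = \sup_{\theta \in A} \pi_x(\theta)$ for $A \subseteq \mathbb{T}$. $\pi_X(\theta)$ and $\overline{\Pi}_X(A)$ denote these quantities evaluated at the random data $x = X$. The inferential model (IM) is the map $x \mapsto \overline{\Pi}_x$.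 *)

theory Defs
  imports "HOL-Probability.Probability"
begin

definition likelihood :: "('t \<Rightarrow> 'x \<Rightarrow> real) \<Rightarrow> 'x \<Rightarrow> 't \<Rightarrow> real" where
  "likelihood p x \<theta> = p \<theta> x"

definition rel_likelihood :: "'t set \<Rightarrow> ('t \<Rightarrow> 'x \<Rightarrow> real) \<Rightarrow> 'x \<Rightarrow> 't \<Rightarrow> real" where
  "rel_likelihood T p x \<theta> = likelihood p x \<theta> / (SUP t\<in>T. likelihood p x t)"

text \<open>
  The sample space is the carrier of the dominating measure \<open>N\<close> (not required to be sigma-finite).
  The supremum of the likelihood is a real supremum, so its finiteness is \<open>likelihood_bdd\<close>.
  Measurability of the relative likelihood is a separate assumption because \<open>T\<close> may be uncountable.
\<close>
locale statistical_model =
  fixes N :: "'x measure"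
    and T :: "'t set"
    and P :: "'t \<Rightarrow> 'x measure"
    and p :: "'t \<Rightarrow> 'x \<Rightarrow> real"
  assumes prob_space_P: "\<And>\<theta>. \<theta> \<in> T \<Longrightarrow> prob_space (P \<theta>)"
    and p_measurable: "\<And>\<theta>. \<theta> \<in> T \<Longrightarrow> p \<theta> \<in> borel_measurable N"
    and p_nonneg: "\<And>\<theta> x. \<theta> \<in> T \<Longrightarrow> x \<in> space N \<Longrightarrow> 0 \<le> p \<theta> x"
    and P_density: "\<And>\<theta>. \<theta> \<in> T \<Longrightarrow> P \<theta> = density N (\<lambda>x. ennreal (p \<theta> x))"
    and likelihood_bdd: "\<And>x. x \<in> space N \<Longrightarrow> bdd_above (likelihood p x ` T)"
    and likelihood_pos: "\<And>x. x \<in> space N \<Longrightarrow> 0 < (SUP t\<in>T. likelihood p x t)"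
    and rel_likelihood_measurable:
      "\<And>\<theta>. \<theta> \<in> T \<Longrightarrow> (\<lambda>x. rel_likelihood T p x \<theta>) \<in> borel_measurable N"

definition contour ::
    "'t set \<Rightarrow> ('t \<Rightarrow> 'x measure) \<Rightarrow> ('t \<Rightarrow> 'x \<Rightarrow> real) \<Rightarrow> 'x \<Rightarrow> 't \<Rightarrow> real" where
  "contour T P p x \<theta> = \<P>(y in P \<theta>. rel_likelihood T p y \<theta> \<le> rel_likelihood T p x \<theta>)"

text \<open>
  Contour values lie in \<open>[0,1]\<close>, so the supremum over the empty set is \<open>0\<close>;
  the real-valued \<open>SUP\<close> is unspecified there.
\<close>
definition possibility ::
    "'t set \<Rightarrow> ('t \<Rightarrow> 'x measure) \<Rightarrow> ('t \<Rightarrow> 'x \<Rightarrow> real) \<Rightarrow> 'x \<Rightarrow> 't set \<Rightarrow> real" where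
  "possibility T P p x A = (if A = {} then 0 else SUP \<theta>\<in>A. contour T P p x \<theta>)"

definition rejects ::
    "'t set \<Rightarrow> ('t \<Rightarrow> 'x measure) \<Rightarrow> ('t \<Rightarrow> 'x \<Rightarrow> real) \<Rightarrow> real \<Rightarrow> 't set \<Rightarrow> 'x \<Rightarrow> bool" where
  "rejects T P p \<alpha> A x \<longleftrightarrow> possibility T P p x A \<le> \<alpha>"

definition confidence_set ::
    "'t set \<Rightarrow> ('t \<Rightarrow> 'x measure) \<Rightarrow> ('t \<Rightarrow> 'x \<Rightarrow> real) \<Rightarrow> real \<Rightarrow> 'x \<Rightarrow> 't set" where
  "confidence_set T P p \<alpha> x = {\<theta> \<in> T. contour T P p x \<theta> > \<alpha>}"

end

theory Submission
  imports Defs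
begin

text \<open>
  Both claims rest on one fact: the value \<open>F (f x)\<close> of the distribution function \<open>F\<close> of a real
  random variable \<open>f\<close> at \<open>f\<close> itself is stochastically no smaller than a uniform variable
  (\<open>prob_cdf_transform_le\<close>). Indeed \<open>{t. F t \<le> \<alpha>}\<close> is a lower set of reals, hence empty or an increasing
  union of half-lines \<open>{..t n}\<close> with \<open>F (t n) \<le> \<alpha>\<close>, and continuity from below gives probability
  at most \<open>\<alpha>\<close> to the event that \<open>f\<close> falls into it. The argument covers atoms of \<open>f\<close>.

  For fixed \<open>\<theta>\<close>, the contour at \<open>x\<close> is exactly this transform of the relative likelihood under
  \<open>P \<theta>\<close>, so \<open>{x. contour T P p x \<theta> \<le> \<alpha>}\<close> is an event of probability at most \<open>\<alpha>\<close>. It contains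
  the rejection region of every hypothesis \<open>A\<close> with \<open>\<theta> \<in> A\<close>, because the possibility of \<open>A\<close>
  dominates the contour at \<open>\<theta>\<close>; being measurable, it also bounds the outer probability of that
  region. Its complement is the event that the confidence set covers \<open>\<theta>\<close>.
\<close>

text \<open>
  Rationals in \<open>S\<close> reach every point of \<open>S\<close> that has a larger one in \<open>S\<close>; only a greatest element
  can escape them. A countable cofinal set made of these becomes a sequence by running maxima.
\<close>
lemma real_lower_set_cofinal_incseq:
  fixes S :: "real set"
  assumes "S \<noteq> {}" and lower: "\<And>s t. s \<in> S \<Longrightarrow> t \<le> s \<Longrightarrow> t \<in> S"
  obtains t :: "nat \<Rightarrow> real" where "incseq t" "range t \<subseteq> S" "\<And>s. s \<in> S \<Longrightarrow> \<exists>n. s \<le> t n"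
proof -
  define D where "D = (\<rat> \<inter> S) \<union> {s \<in> S. \<forall>u\<in>S. u \<le> s}"
  have "{s \<in> S. \<forall>u\<in>S. u \<le> s} \<subseteq> {Sup S}"
    by (auto intro!: cSup_eq_maximum[symmetric])
  then have "countable D"
    unfolding D_def by (auto intro: countable_rat countable_subset)
  have D_cofinal: "\<exists>d\<in>D. s \<le> d" if "s \<in> S" for s
  proof (cases "\<exists>u\<in>S. s < u")
    case True
    then obtain u where "u \<in> S" "s < u" by blast
    moreover obtain q where "q \<in> \<rat>" "s < q" "q < u"
      using Rats_dense_in_real[OF \<open>s < u\<close>] by blast
    ultimately show ?thesis
      using lower[of u q] by (auto simp: D_def intro!: bexI[of _ q])
  next
    case False
    with that show ?thesis by (auto simp: D_def not_less intro!: bexI[of _ s])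
  qed
  have "D \<noteq> {}" using D_cofinal \<open>S \<noteq> {}\<close> by blast
  define t where "t n = Max (from_nat_into D ` {..n})" for n :: nat
  show thesis
  proof
    show "incseq t"
      unfolding t_def by (intro incseq_SucI Max_mono) auto
    have "t n \<in> from_nat_into D ` {..n}" for n
      unfolding t_def by (rule Max_in) auto
    moreover have "from_nat_into D ` {..n} \<subseteq> D" for n
      using from_nat_into[OF \<open>D \<noteq> {}\<close>] by blast
    ultimately have "range t \<subseteq> D" by blast
    then show "range t \<subseteq> S" by (auto simp: D_def)
    fix s assume "s \<in> S"
    then obtain d where "d \<in> D" "s \<le> d" using D_cofinal by blast
    moreover obtain n where "from_nat_into D n = d"
      using from_nat_into_surj[OF \<open>countable D\<close> \<open>d \<in> D\<close>] by blast
    moreover have "from_nat_into D n \<le> t n"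
      unfolding t_def by (rule Max_ge) auto
    ultimately show "\<exists>n. s \<le> t n" by (auto intro: order_trans)
  qed
qed

lemma (in prob_space) cdf_transform_le_event:
  fixes f :: "'a \<Rightarrow> real"
  assumes [measurable]: "f \<in> borel_measurable M"
  shows "{x \<in> space M. \<P>(y in M. f y \<le> f x) \<le> \<alpha>} \<in> events"
proof -
  have "mono (\<lambda>t. \<P>(y in M. f y \<le> t))"
    by (intro monoI finite_measure_mono) auto
  then have [measurable]: "(\<lambda>t. \<P>(y in M. f y \<le> t)) \<in> borel_measurable borel"
    by (rule borel_measurable_mono)
  show ?thesis by measurable
qed

text \<open>
  No continuity of the distribution is assumed, so only an inequality can hold: an atom of \<open>f\<close>
  makes the distribution function jump over some levels \<open>\<alpha>\<close>.
\<close>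
lemma (in prob_space) prob_cdf_transform_le:
  fixes f :: "'a \<Rightarrow> real"
  assumes [measurable]: "f \<in> borel_measurable M" and "0 \<le> \<alpha>"
  shows "\<P>(x in M. \<P>(y in M. f y \<le> f x) \<le> \<alpha>) \<le> \<alpha>"
proof -
  define F where "F t = \<P>(y in M. f y \<le> t)" for t
  define S where "S = {t. F t \<le> \<alpha>}"
  have F_mono: "F s \<le> F t" if "s \<le> t" for s t
    unfolding F_def using that by (intro finite_measure_mono) auto
  have "\<P>(x in M. f x \<in> S) \<le> \<alpha>"
  proof (cases "S = {}")
    case True
    with \<open>0 \<le> \<alpha>\<close> show ?thesis by simp
  next
    case False
    have lower: "t \<in> S" if "s \<in> S" "t \<le> s" for s t
      using that F_mono[of t s] by (simp add: S_def)
    obtain t :: "nat \<Rightarrow> real"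
      where t: "incseq t" "range t \<subseteq> S" "\<And>s. s \<in> S \<Longrightarrow> \<exists>n. s \<le> t n"
      using real_lower_set_cofinal_incseq[OF False] lower by metis
    define E where "E n = {x \<in> space M. f x \<le> t n}" for n
    have "(\<lambda>n. prob (E n)) \<longlonglongrightarrow> prob (\<Union>n. E n)"
    proof (rule finite_Lim_measure_incseq)
      show "range E \<subseteq> events" by (auto simp: E_def)
      show "incseq E"
        using t(1) by (auto simp: E_def incseq_def intro: order_trans)
    qed
    moreover have "(\<Union>n. E n) = {x \<in> space M. f x \<in> S}"
      using t(2,3) lower by (fastforce simp: E_def)
    moreover have "prob (E n) \<le> \<alpha>" for n
      using t(2) by (auto simp: E_def S_def F_def)
    ultimately show ?thesis
      by (auto intro: LIMSEQ_le_const2)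
  qed
  then show ?thesis by (simp add: S_def F_def)
qed

context statistical_model
begin

lemma sets_P: "\<theta> \<in> T \<Longrightarrow> sets (P \<theta>) = sets N"
  by (simp add: P_density)

lemma rel_likelihood_measurable_P:
  "\<theta> \<in> T \<Longrightarrow> (\<lambda>x. rel_likelihood T p x \<theta>) \<in> borel_measurable (P \<theta>)"
  using rel_likelihood_measurable by (simp cong: measurable_cong_sets add: sets_P)

lemma contour_le_event:
  assumes "\<theta> \<in> T"
  shows "{x \<in> space (P \<theta>). contour T P p x \<theta> \<le> \<alpha>} \<in> sets (P \<theta>)"
  unfolding contour_def
  by (rule prob_space.cdf_transform_le_event[OF prob_space_P rel_likelihood_measurable_P])
     (use assms in auto)

lemma prob_contour_le:
  assumes "\<theta> \<in> T" "0 \<le> \<alpha>"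
  shows "\<P>(x in P \<theta>. contour T P p x \<theta> \<le> \<alpha>) \<le> \<alpha>"
  unfolding contour_def
  by (rule prob_space.prob_cdf_transform_le[OF prob_space_P rel_likelihood_measurable_P])
     (use assms in auto)

lemma contour_le_possibility:
  assumes "A \<subseteq> T" "\<theta> \<in> A"
  shows "contour T P p x \<theta> \<le> possibility T P p x A"
proof -
  have "bdd_above (contour T P p x ` A)"
    using assms(1) prob_space_P
    by (auto intro!: bdd_aboveI2[where M = 1] prob_space.prob_le_1 simp: contour_def)
  then show ?thesis
    using assms(2) by (auto simp: possibility_def intro: cSUP_upper)
qed

theorem type_I_error:
  assumes "A \<subseteq> T" "\<theta> \<in> A" "0 \<le> \<alpha>"
  shows "outer_measure_of (P \<theta>) {x \<in> space (P \<theta>). rejects T P p \<alpha> A x} \<le> ennreal \<alpha>"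
proof -
  have "\<theta> \<in> T" using assms by blast
  then interpret P: prob_space "P \<theta>" by (rule prob_space_P)
  let ?E = "{x \<in> space (P \<theta>). contour T P p x \<theta> \<le> \<alpha>}"
  have "{x \<in> space (P \<theta>). rejects T P p \<alpha> A x} \<subseteq> ?E"
    using contour_le_possibility[OF assms(1,2)] by (auto simp: rejects_def intro: order_trans)
  then have "outer_measure_of (P \<theta>) {x \<in> space (P \<theta>). rejects T P p \<alpha> A x}
      \<le> emeasure (P \<theta>) ?E"
    unfolding outer_measure_of_def
    using contour_le_event[OF \<open>\<theta> \<in> T\<close>] by (intro INF_lower) auto
  also have "\<dots> \<le> ennreal \<alpha>"
    using prob_contour_le[OF \<open>\<theta> \<in> T\<close> \<open>0 \<le> \<alpha>\<close>]
    by (simp add: P.emeasure_eq_measure ennreal_leI)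
  finally show ?thesis .
qed

theorem confidence_set_coverage:
  assumes "\<theta> \<in> T" "0 \<le> \<alpha>"
  shows "\<P>(x in P \<theta>. \<theta> \<in> confidence_set T P p \<alpha> x) \<ge> 1 - \<alpha>"
proof -
  interpret P: prob_space "P \<theta>" using assms(1) by (rule prob_space_P)
  have "\<P>(x in P \<theta>. \<not> contour T P p x \<theta> \<le> \<alpha>) = 1 - \<P>(x in P \<theta>. contour T P p x \<theta> \<le> \<alpha>)"
    using contour_le_event[OF assms(1)] by (rule P.prob_neg)
  then show ?thesis
    using prob_contour_le[OF assms] assms(1) by (simp add: confidence_set_def not_le)
qed

end

theorem mainTheorem2:
  fixes N :: "'x measure"
    and T :: "'t set"
    and P :: "'t \<Rightarrow> 'x measure"
    and p :: "'t \<Rightarrow> 'x \<Rightarrow> real"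
  assumes "statistical_model N T P p"
  shows "\<forall>\<alpha>\<in>{0..1::real}.
    (\<forall>A\<subseteq>T. \<forall>\<Theta>\<in>A.
       outer_measure_of (P \<Theta>) {x \<in> space (P \<Theta>). rejects T P p \<alpha> A x} \<le> ennreal \<alpha> \<and>
       ({x \<in> space (P \<Theta>). rejects T P p \<alpha> A x} \<in> sets (P \<Theta>) \<longrightarrow>
          \<P>(x in P \<Theta>. rejects T P p \<alpha> A x) \<le> \<alpha>)) \<and>
    (\<forall>\<Theta>\<in>T. \<P>(x in P \<Theta>. \<Theta> \<in> confidence_set T P p \<alpha> x) \<ge> 1 - \<alpha>)"
proof (intro ballI conjI allI impI)
  interpret statistical_model N T P p by fact
  fix \<alpha> :: real assume "\<alpha> \<in> {0..1}"
  then have "0 \<le> \<alpha>" by simp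
  show "\<P>(x in P \<Theta>. \<Theta> \<in> confidence_set T P p \<alpha> x) \<ge> 1 - \<alpha>" if "\<Theta> \<in> T" for \<Theta>
    using that \<open>0 \<le> \<alpha>\<close> by (rule confidence_set_coverage)
  fix A \<Theta> assume A: "A \<subseteq> T" "\<Theta> \<in> A"
  show outer: "outer_measure_of (P \<Theta>) {x \<in> space (P \<Theta>). rejects T P p \<alpha> A x} \<le> ennreal \<alpha>"
    using A \<open>0 \<le> \<alpha>\<close> by (rule type_I_error)
  interpret P: prob_space "P \<Theta>" using A by (intro prob_space_P) auto
  assume "{x \<in> space (P \<Theta>). rejects T P p \<alpha> A x} \<in> sets (P \<Theta>)"
  with outer show "\<P>(x in P \<Theta>. rejects T P p \<alpha> A x) \<le> \<alpha>"
    using \<open>0 \<le> \<alpha>\<close> by (simp add: P.emeasure_eq_measure)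
qed

end
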